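(* Let $p$ be a real number with $0\le p<\frac12$ and let $\lambda_n=\frac1e+\frac1{n^p}$ for $n\ge1$. Then $J(\lambda_n)=\mathbb{C}$.
   Context: For a bounded sequence $(\lambda_n)_{n\ge1}$ of positive real numbers put $f_{\lambda_n}(z)=\lambda_n e^z$ for $z\in\mathbb{C}$, and $F_n=f_{\lambda_n}\circ f_{\lambda_{n-1}}\circ\dots\circ f_{\lambda_1}$. The Fatou set $F(\lambda_n)$ is the set of all $z\in\mathbb{C}$ having an open neighbourhood on which the family $(F_n)_{n\ge 1}$ is normal, i.e. every sequence of members of the family has a subsequence converging almost uniformly (locally uniformly; as usual for normal families, convergence to $\infty$ is allowed). The Julia set is $J(\lambda_n)=\mathbb{C}\setminus F(\lambda_n)$. *)

theory Defs
  imports "HOL-Complex_Analysis.Complex_Analysis"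
begin

definition exp_map :: "real \<Rightarrow> complex \<Rightarrow> complex" where
  "exp_map l z = of_real l * exp z"

(* exp_iter lam n is the composition of exp_map (lam n), ..., exp_map (lam 1), in this order;
   the value lam 0 is never used. *)
primrec exp_iter :: "(nat \<Rightarrow> real) \<Rightarrow> nat \<Rightarrow> complex \<Rightarrow> complex" where
  "exp_iter lam 0 = id"
| "exp_iter lam (Suc n) = exp_map (lam (Suc n)) \<circ> exp_iter lam n"

definition uniformly_to_infinity :: "complex set \<Rightarrow> (nat \<Rightarrow> complex \<Rightarrow> complex) \<Rightarrow> bool" where
  "uniformly_to_infinity V f \<longleftrightarrow> (\<forall>B. \<forall>\<^sub>F n in sequentially. \<forall>z\<in>V. B \<le> norm (f n z))"

(* Locally uniform convergence on U, with the limit infinity allowed. The alternative is taken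
   locally because U need not be connected: the limit may be finite on one component and
   infinite on another. For sequences of holomorphic functions this is locally uniform
   convergence in the spherical metric. *)
definition locally_uniformly_convergent_on ::
    "complex set \<Rightarrow> (nat \<Rightarrow> complex \<Rightarrow> complex) \<Rightarrow> bool" where
  "locally_uniformly_convergent_on U f \<longleftrightarrow>
     (\<forall>z\<in>U. \<exists>V. open V \<and> z \<in> V \<and> V \<subseteq> U \<and>
        ((\<exists>g. uniform_limit V f g sequentially) \<or> uniformly_to_infinity V f))"

definition normal_family_on :: "complex set \<Rightarrow> (complex \<Rightarrow> complex) set \<Rightarrow> bool" where
  "normal_family_on U \<F> \<longleftrightarrow>
     (\<forall>f :: nat \<Rightarrow> complex \<Rightarrow> complex. range f \<subseteq> \<F> \<longrightarrow>
        (\<exists>r :: nat \<Rightarrow> nat. strict_mono r \<and> locally_uniformly_convergent_on U (f \<circ> r)))"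

definition fatou_set :: "(nat \<Rightarrow> real) \<Rightarrow> complex set" where
  "fatou_set lam =
     {z. \<exists>U. open U \<and> z \<in> U \<and> normal_family_on U (exp_iter lam ` {1..})}"

definition julia_set :: "(nat \<Rightarrow> real) \<Rightarrow> complex set" where
  "julia_set lam = UNIV - fatou_set lam"

end

theory Submission
  imports Defs
begin

text \<open>
  Along every orbit \<open>F\<^sub>k z = x\<^sub>k + i y\<^sub>k\<close> one has \<open>x\<^sub>k\<^sub>+\<^sub>1 = \<lambda>\<^sub>k\<^sub>+\<^sub>1 exp x\<^sub>k cos y\<^sub>k\<close> and
  \<open>exp x \<ge> e x\<close>, so if the sum of \<open>1 - cos y\<^sub>k\<close> converges while that of \<open>\<lambda>\<^sub>k - 1/e\<close>
  diverges, then \<open>x\<^sub>k\<close> and \<open>\<bar>F\<^sub>k' z\<bar> = \<bar>F\<^sub>1 z \<dots> F\<^sub>k z\<bar>\<close> tend to infinity.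
  This applies to every orbit that hits the real line. On a disc where the family is normal, such
  an orbit would force \<open>F\<^sub>n\<close>, for suitable large \<open>n\<close>, to map the disc into the strip
  \<open>\<bar>Im w\<bar> < \<pi>/2\<close>, which bounds \<open>F\<^sub>n'\<close>. Hence every \<open>F\<^sub>n\<close> maps the disc into the upper or the
  lower half-plane, so \<open>\<bar>F\<^sub>n' z\<bar> / \<bar>y\<^sub>n\<bar>\<close> is bounded. Up to a constant this
  quotient is the product of the factors \<open>\<bar>y\<^sub>k / sin y\<^sub>k\<bar> \<ge> 1 + (1 - cos y\<^sub>k) / 4\<close>, whence
  the sum of \<open>1 - cos y\<^sub>k\<close> converges. Therefore \<open>\<bar>F\<^sub>n' z\<bar>\<close>, and with it \<open>\<bar>y\<^sub>n\<bar>\<close>, tends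
  to infinity, although the bounded product dominates each factor and thus \<open>\<bar>y\<^sub>n\<bar>\<close>.
\<close>

section \<open>A half-plane derivative bound and a trigonometric inequality\<close>

text \<open>A Schwarz-Pick type bound, with \<open>exp 1\<close> in place of the sharp constant 2:
  exponentiating maps the half-plane into the unit disc, where Cauchy's inequality applies.\<close>

lemma norm_deriv_le_Im:
  assumes hol: "g holomorphic_on ball z R" and "R > 0"
    and pos: "\<And>w. w \<in> ball z R \<Longrightarrow> Im (g w) > 0"
  shows "norm (deriv g z) \<le> exp 1 * Im (g z) / R"
proof -
  \<comment> \<open>For any \<open>s > 0\<close> the argument gives
    \<open>norm (deriv g z) \<le> exp (s * Im (g z)) / (s * R)\<close>; this \<open>s\<close>
    minimises the right-hand side.\<close>
  define s where "s = 1 / Im (g z)"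
  have z: "z \<in> ball z R" using \<open>R > 0\<close> by simp
  have s: "s > 0" using pos[OF z] by (simp add: s_def)
  define h where "h = (\<lambda>w. exp (\<i> * of_real s * g w))"
  have h_hol: "h holomorphic_on ball z R"
    unfolding h_def by (intro holomorphic_intros hol)
  have h_le: "norm (h w) \<le> 1" if "w \<in> ball z R" for w
    using s pos[OF that] by (simp add: h_def)
  have "(g has_field_derivative deriv g z) (at z)"
    using hol z by (intro holomorphic_derivI[where S = "ball z R"]) auto
  then have "(h has_field_derivative (h z * (\<i> * of_real s * deriv g z))) (at z)"
    unfolding h_def by (auto intro!: derivative_eq_intros)
  then have dh: "deriv h z = h z * (\<i> * of_real s * deriv g z)"
    by (rule DERIV_imp_deriv)
  have nh: "norm (h z) = exp (-1)"
    using pos[OF z] by (simp add: h_def s_def)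
  have bound: "norm (deriv h z) \<le> 1 / r" if r: "0 < r" "r < R" for r
  proof -
    have sub: "cball z r \<subseteq> ball z R" using r by auto
    have "norm ((deriv ^^ 1) h z) \<le> fact 1 * 1 / r ^ 1"
    proof (rule Cauchy_inequality)
      show "h holomorphic_on ball z r"
        using h_hol by (rule holomorphic_on_subset) (use r in auto)
      show "continuous_on (cball z r) h"
        using holomorphic_on_imp_continuous_on[OF h_hol] sub continuous_on_subset by blast
      show "norm (h x) \<le> 1" if "norm (z - x) = r" for x
        using that r by (intro h_le) (simp add: dist_norm)
    qed (use r in auto)
    then show ?thesis by simp
  qed
  \<comment> \<open>Cauchy's inequality needs closed discs inside the ball, so \<open>R\<close> is
    reached as the limit of radii \<open>r < R\<close>.\<close>
  have "norm (deriv h z) * R \<le> 1"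
  proof (rule ccontr)
    assume "\<not> ?thesis"
    then have d: "norm (deriv h z) > 0" by auto
    with \<open>\<not> ?thesis\<close> have "1 / norm (deriv h z) < R" by (simp add: field_simps)
    then obtain r where r: "1 / norm (deriv h z) < r" "r < R"
      using dense by blast
    then have "r > 0" using d by (meson less_trans zero_less_divide_1_iff)
    then show False using bound[of r] r d by (simp add: field_simps)
  qed
  then have "exp (-1) * (s * norm (deriv g z)) * R \<le> 1"
    using s by (simp add: dh norm_mult nh)
  then show ?thesis
    using pos[OF z] \<open>R > 0\<close> by (simp add: s_def exp_minus field_simps)
qed

text \<open>The half-angle formula gives \<open>\<bar>sin y\<bar> \<le> \<bar>y\<bar> * u\<close>
  with \<open>u = \<bar>cos (y / 2)\<bar>\<close>, and the left-hand side is
  \<open>(3 - u\<^sup>2) / 2 \<le> 1 / u\<close>.\<close>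

lemma one_minus_cos_le:
  fixes y :: real
  assumes "sin y \<noteq> 0"
  shows "1 + (1 - cos y) / 4 \<le> \<bar>y\<bar> / \<bar>sin y\<bar>"
proof -
  define u where "u = \<bar>cos (y / 2)\<bar>"
  have sy: "sin y = 2 * sin (y / 2) * cos (y / 2)"
    using sin_double[of "y / 2"] by simp
  have u: "0 < u" "u \<le> 1" using assms sy by (auto simp: u_def)
  have cy: "cos y = 2 * u\<^sup>2 - 1"
    using cos_double_cos[of "y / 2"] by (simp add: u_def)
  have sin_le: "\<bar>sin y\<bar> \<le> \<bar>y\<bar> * u"
    using abs_sin_x_le_abs_x[of "y / 2"] u by (simp add: sy u_def abs_mult mult_right_mono)
  have factor_le: "(1 + (1 - cos y) / 4) * u \<le> 1"
  proof -
    have "(1 - u) * (2 - u - u\<^sup>2) \<ge> 0"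
      using u power_le_one[of u 2] by (intro mult_nonneg_nonneg) auto
    then have "3 * u - u ^ 3 \<le> 2"
      by (simp add: algebra_simps power2_eq_square power3_eq_cube)
    then show ?thesis
      by (simp add: cy field_simps power2_eq_square power3_eq_cube)
  qed
  have "(1 + (1 - cos y) / 4) * \<bar>sin y\<bar> \<le> (1 + (1 - cos y) / 4) * (\<bar>y\<bar> * u)"
    using sin_le by (intro mult_left_mono) (auto simp: add_nonneg_nonneg)
  also have "\<dots> = \<bar>y\<bar> * ((1 + (1 - cos y) / 4) * u)" by simp
  also have "\<dots> \<le> \<bar>y\<bar>"
    using mult_left_mono[OF factor_le abs_ge_zero[of y]] by simp
  finally have "(1 + (1 - cos y) / 4) * \<bar>sin y\<bar> \<le> \<bar>y\<bar>" .
  then show ?thesis using assms by (simp add: field_simps)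
qed

section \<open>The iterates and their derivatives\<close>

lemma exp_iter_holomorphic [holomorphic_intros]: "exp_iter lam n holomorphic_on S"
proof (induction n)
  case (Suc n)
  then show ?case
    by (auto simp: exp_map_def comp_def intro!: holomorphic_intros)
qed (simp add: id_def)

text \<open>Each \<open>exp_map\<close> is its own derivative, so the chain rule multiplies the
  orbit points.\<close>

lemma deriv_exp_iter: "deriv (exp_iter lam n) z = (\<Prod>k<n. exp_iter lam (Suc k) z)"
proof (induction n)
  case (Suc n)
  have "(exp_iter lam n has_field_derivative deriv (exp_iter lam n) z) (at z)"
    by (intro holomorphic_derivI[OF exp_iter_holomorphic[of _ _ UNIV]]) auto
  then have "(exp_iter lam (Suc n) has_field_derivative
      of_real (lam (Suc n)) * (exp (exp_iter lam n z) * deriv (exp_iter lam n) z)) (at z)"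
    by (auto simp: exp_map_def comp_def intro!: derivative_eq_intros)
  then show ?case
    by (simp add: DERIV_imp_deriv Suc.IH exp_map_def mult_ac del: exp_iter.simps(2))
       (simp add: exp_map_def mult_ac)
qed (simp add: id_def)

lemma Re_exp_iter_Suc:
  "Re (exp_iter lam (Suc n) z) = lam (Suc n) * exp (Re (exp_iter lam n z)) * cos (Im (exp_iter lam n z))"
  by (simp add: exp_map_def Re_exp)

lemma Im_exp_iter_Suc:
  "Im (exp_iter lam (Suc n) z) = lam (Suc n) * exp (Re (exp_iter lam n z)) * sin (Im (exp_iter lam n z))"
  by (simp add: exp_map_def Im_exp)

lemma norm_exp_iter_Suc:
  "norm (exp_iter lam (Suc n) z) = \<bar>lam (Suc n)\<bar> * exp (Re (exp_iter lam n z))"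
  by (simp add: exp_map_def norm_mult)

section \<open>Divergent products and sums\<close>

lemma filterlim_prod_at_top:
  fixes f :: "nat \<Rightarrow> real"
  assumes f: "filterlim f at_top sequentially" and pos: "\<And>n. f n > 0"
  shows "filterlim (\<lambda>n. \<Prod>k<n. f k) at_top sequentially"
proof -
  obtain N where N: "\<And>n. n \<ge> N \<Longrightarrow> f n \<ge> 1"
    using f by (auto simp: filterlim_at_top eventually_sequentially)
  define c where "c = (\<Prod>k<N. f k)"
  have c: "c > 0" unfolding c_def by (intro prod_pos) (simp add: pos)
  have ge: "(\<Prod>k<n. f k) \<ge> c" if "n \<ge> N" for n
    using that
  proof (induction n rule: dec_induct)
    case (step n)
    have "c * 1 \<le> (\<Prod>k<n. f k) * f n"
      using step N[of n] c by (intro mult_mono) auto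
    then show ?case by simp
  qed (simp add: c_def)
  have "filterlim (\<lambda>n. c * f n) at_top sequentially"
    using f c by (simp add: filterlim_tendsto_pos_mult_at_top[OF tendsto_const])
  moreover have "\<forall>\<^sub>F n in sequentially. c * f n \<le> (\<Prod>k<Suc n. f k)"
    using eventually_ge_at_top[of N]
    by eventually_elim (simp add: ge pos less_imp_le mult_right_mono)
  ultimately have "filterlim (\<lambda>n. \<Prod>k<Suc n. f k) at_top sequentially"
    by (rule filterlim_at_top_mono)
  then show ?thesis by (subst (asm) filterlim_sequentially_Suc)
qed

lemma filterlim_sum_at_top:
  fixes f :: "nat \<Rightarrow> real"
  assumes "\<not> summable f" and nonneg: "\<And>n. f n \<ge> 0"
  shows "filterlim (\<lambda>n. \<Sum>k<n. f k) at_top sequentially"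
  unfolding filterlim_at_top eventually_sequentially
proof (intro allI)
  fix B
  obtain n where n: "(\<Sum>k\<le>n. f k) > B"
    using bounded_imp_summable[of f B] assms by (meson not_le)
  have "B \<le> (\<Sum>k<m. f k)" if "m \<ge> Suc n" for m
  proof -
    have "(\<Sum>k\<le>n. f k) \<le> (\<Sum>k<m. f k)"
      using that nonneg by (intro sum_mono2) auto
    with n show ?thesis by linarith
  qed
  then show "\<exists>N. \<forall>m\<ge>N. B \<le> (\<Sum>k<m. f k)" by blast
qed

section \<open>Growth along orbits with summable \<open>1 - cos\<close>\<close>

text \<open>Each step adds at least the excess of \<open>lam\<close> over \<open>1 / exp 1\<close>
  to the real part and then damps it by a cosine; from some index on, the total damping costs at
  most half of the accumulated excess.\<close>

lemma Re_exp_iter_at_top: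
  assumes ge: "\<And>n. lam n \<ge> 1 / exp 1"
    and nsum: "\<not> summable (\<lambda>n. lam n - 1 / exp 1)"
    and a: "summable (\<lambda>k. 1 - cos (Im (exp_iter lam k z)))"
  shows "filterlim (\<lambda>k. Re (exp_iter lam k z)) at_top sequentially"
proof -
  define a where "a = (\<lambda>k. 1 - cos (Im (exp_iter lam k z)))"
  define x where "x = (\<lambda>k. Re (exp_iter lam k z))"
  define e where "e = (\<lambda>k. lam k - 1 / exp 1)"
  have a0: "a k \<ge> 0" for k by (simp add: a_def)
  have e0: "e k \<ge> 0" for k using ge[of k] by (simp add: e_def)
  have sa: "summable a" using a by (simp add: a_def)
  obtain N where N: "\<And>n. norm (\<Sum>k. a (k + N)) < 1 / 2"
    using suminf_exist_split[OF _ sa, of "1/2"] by (auto simp: add.commute)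
  have S: "(\<Sum>i<j. a (N + i)) \<le> 1 / 2" for j
  proof -
    have "(\<Sum>i<j. a (i + N)) \<le> (\<Sum>k. a (k + N))"
      using sa by (intro sum_le_suminf) (auto simp: summable_iff_shift a0)
    then show ?thesis using N by (simp add: add.commute)
  qed
  have a1: "a (N + j) \<le> 1 / 2" for j
  proof -
    have "a (N + j) \<le> (\<Sum>i<Suc j. a (N + i))"
      using a0 by (simp add: sum_nonneg)
    then show ?thesis using S[of "Suc j"] by linarith
  qed
  have xS: "x (Suc k) = (1 / exp 1 + e (Suc k)) * exp (x k) * (1 - a k)" for k
    unfolding x_def Re_exp_iter_Suc by (simp add: a_def e_def)
  \<comment> \<open>The index starts at \<open>N + 1\<close> because \<open>x N\<close> may be
    negative; one step with \<open>cos \<ge> 1 / 2\<close> makes the real part nonnegative.\<close>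
  have xpos: "x (N + Suc j) \<ge> 0" for j
    using xS[of "N + j"] a1[of j] e0[of "Suc (N + j)"] by (simp add: add_pos_nonneg)
  \<comment> \<open>The product of the damping factors \<open>1 - a\<close> is replaced by its lower
    bound, one minus their sum.\<close>
  have main: "(1 - (\<Sum>i<j. a (N + Suc i))) * (\<Sum>i<j. e (N + Suc (Suc i))) \<le> x (N + Suc j)" for j
  proof (induction j)
    case 0
    then show ?case using xpos[of 0] by simp
  next
    case (Suc j)
    define A where "A = (\<Sum>i<j. a (N + Suc i))"
    define E where "E = (\<Sum>i<j. e (N + Suc (Suc i)))"
    define b where "b = a (N + Suc j)"
    define d where "d = e (N + Suc (Suc j))"
    define y where "y = x (N + Suc j)"
    have IH: "(1 - A) * E \<le> y" using Suc by (simp add: A_def E_def y_def)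
    have nn: "A \<ge> 0" "E \<ge> 0" "b \<ge> 0" "d \<ge> 0" "y \<ge> 0" "b \<le> 1/2"
      unfolding A_def E_def b_def d_def y_def
      using a0 e0 xpos a1[of "Suc j"] by (auto intro: sum_nonneg)
    \<comment> \<open>Here \<open>1 / exp 1\<close> is the critical parameter:
      \<open>exp y / exp 1\<close> never lies below \<open>y\<close>.\<close>
    have "y \<le> exp (y - 1)" using exp_ge_add_one_self[of "y - 1"] by simp
    then have y1: "y \<le> 1 / exp 1 * exp y" by (simp add: exp_diff)
    have "d * 1 \<le> d * exp y" using nn by (intro mult_left_mono) auto
    then have "y + d \<le> (1 / exp 1 + d) * exp y" using y1 by (simp add: algebra_simps)
    then have step: "(y + d) * (1 - b) \<le> (1 / exp 1 + d) * exp y * (1 - b)"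
      using nn by (intro mult_right_mono) auto
    have "(1 - (A + b)) * (E + d) \<le> (1 - A) * (1 - b) * (E + d)"
      using nn by (intro mult_right_mono) (auto simp: algebra_simps)
    also have "\<dots> = ((1 - A) * E + (1 - A) * d) * (1 - b)" by (simp add: algebra_simps)
    also have "\<dots> \<le> (y + d) * (1 - b)"
      using nn IH by (intro mult_right_mono add_mono) (auto simp: algebra_simps)
    also note step
    also have "(1 / exp 1 + d) * exp y * (1 - b) = x (N + Suc (Suc j))"
      using xS[of "N + Suc j"] by (simp add: b_def d_def y_def)
    finally show ?case by (simp add: A_def E_def b_def d_def)
  qed
  have A_half: "(\<Sum>i<j. a (N + Suc i)) \<le> 1 / 2" for j
  proof -
    have "(\<Sum>i<Suc j. a (N + i)) = a N + (\<Sum>i<j. a (N + Suc i))"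
      by (subst sum.lessThan_Suc_shift) simp
    then show ?thesis using S[of "Suc j"] a0[of N] by linarith
  qed
  have lower: "(\<Sum>i<j. e (i + (N + 2))) * (1 / 2) \<le> x (j + (N + 1))" for j
  proof -
    have "(1 / 2) * (\<Sum>i<j. e (N + Suc (Suc i))) \<le>
        (1 - (\<Sum>i<j. a (N + Suc i))) * (\<Sum>i<j. e (N + Suc (Suc i)))"
      using A_half[of j] by (intro mult_right_mono sum_nonneg) (auto simp: e0)
    with main[of j] show ?thesis by (simp add: add.commute)
  qed
  have "\<not> summable (\<lambda>i. e (i + (N + 2)))"
    using nsum by (subst summable_iff_shift) (simp add: e_def)
  then have "filterlim (\<lambda>j. \<Sum>i<j. e (i + (N + 2))) at_top sequentially"
    using e0 by (intro filterlim_sum_at_top)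
  then have "filterlim (\<lambda>j. (\<Sum>i<j. e (i + (N + 2))) * (1 / 2)) at_top sequentially"
    by (rule filterlim_at_top_mult_tendsto_pos[OF tendsto_const, rotated]) auto
  then have "filterlim (\<lambda>j. x (j + (N + 1))) at_top sequentially"
    by (rule filterlim_at_top_mono) (use lower in auto)
  then show ?thesis
    unfolding x_def[symmetric] filterlim_at_top
    using eventually_sequentially_seg[of "\<lambda>k. Z \<le> x k" "N + 1" for Z] by blast
qed

lemma norm_deriv_exp_iter_at_top:
  assumes ge: "\<And>n. lam n \<ge> 1 / exp 1"
    and "\<not> summable (\<lambda>n. lam n - 1 / exp 1)"
    and "summable (\<lambda>k. 1 - cos (Im (exp_iter lam k z)))"
  shows "filterlim (\<lambda>n. norm (deriv (exp_iter lam n) z)) at_top sequentially"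
proof -
  have "filterlim (\<lambda>k. norm (exp_iter lam k z)) at_top sequentially"
    using Re_exp_iter_at_top[OF assms]
    by (rule filterlim_at_top_mono) (simp add: complex_Re_le_cmod)
  then have "filterlim (\<lambda>k. norm (exp_iter lam (Suc k) z)) at_top sequentially"
    by (subst filterlim_sequentially_Suc)
  moreover have "norm (exp_iter lam (Suc k) z) > 0" for k
  proof -
    have "lam (Suc k) > 0" using ge[of "Suc k"] by (rule less_le_trans[rotated]) simp
    then show ?thesis by (simp only: norm_exp_iter_Suc) simp
  qed
  ultimately show ?thesis
    unfolding deriv_exp_iter prod_norm[symmetric] by (rule filterlim_prod_at_top)
qed

section \<open>Normality keeps orbits off the real line\<close>

lemma normal_orbit_not_real:
  assumes ge: "\<And>n. lam n \<ge> 1 / exp 1" and le: "\<And>n. lam n \<le> L"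
    and nsum: "\<not> summable (\<lambda>n. lam n - 1 / exp 1)"
    and normal: "normal_family_on U (exp_iter lam ` {1..})" and "z \<in> U"
  shows "Im (exp_iter lam m z) \<noteq> 0"
proof
  assume "Im (exp_iter lam m z) = 0"
  have lam_pos: "lam n > 0" for n
    using ge[of n] by (rule less_le_trans[rotated]) simp
  have real: "Im (exp_iter lam n z) = 0" if "n \<ge> m" for n
    using that by (induction n rule: dec_induct) (use \<open>Im (exp_iter lam m z) = 0\<close> in
      \<open>auto simp: Im_exp_iter_Suc simp del: exp_iter.simps\<close>)
  have "summable (\<lambda>k. 1 - cos (Im (exp_iter lam k z)))"
    by (rule summable_finite[of "{..<m}"]) (auto simp: real)
  note dlim = norm_deriv_exp_iter_at_top[OF ge nsum this]
    and relim = Re_exp_iter_at_top[OF ge nsum this]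
  \<comment> \<open>The shift by 2 lets information flow back: a large \<open>F_(n+2)\<close> forces
    \<open>Re F_(n+1) > 0\<close>, hence \<open>cos (Im F_n) > 0\<close>.\<close>
  have "range (\<lambda>n. exp_iter lam (n + 2)) \<subseteq> exp_iter lam ` {1..}"
    by (auto simp del: exp_iter.simps add_2_eq_Suc')
  then obtain r where r: "strict_mono r"
    and conv: "locally_uniformly_convergent_on U ((\<lambda>n. exp_iter lam (n + 2)) \<circ> r)"
    using normal unfolding normal_family_on_def by blast
  have rlim: "filterlim r at_top sequentially" by (rule filterlim_subseq[OF r])
  obtain V where V: "open V" "z \<in> V"
    and alt: "(\<exists>g. uniform_limit V ((\<lambda>n. exp_iter lam (n + 2)) \<circ> r) g sequentially) \<or>
      uniformly_to_infinity V ((\<lambda>n. exp_iter lam (n + 2)) \<circ> r)"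
    using conv \<open>z \<in> U\<close> unfolding locally_uniformly_convergent_on_def by blast
  \<comment> \<open>A finite limit at \<open>z\<close> contradicts the divergence of the real parts
    there.\<close>
  have "\<not> uniform_limit V ((\<lambda>n. exp_iter lam (n + 2)) \<circ> r) g sequentially" for g
  proof
    assume "uniform_limit V ((\<lambda>n. exp_iter lam (n + 2)) \<circ> r) g sequentially"
    from tendsto_Re[OF tendsto_uniform_limitI[OF this \<open>z \<in> V\<close>]]
    have "(\<lambda>n. Re (exp_iter lam (r n + 2) z)) \<longlonglongrightarrow> Re (g z)"
      by (simp add: comp_def del: exp_iter.simps add_2_eq_Suc')
    moreover have "filterlim (\<lambda>n. r n + 2) at_top sequentially"
      by (rule filterlim_at_top_mono[OF rlim]) auto
    then have "filterlim (\<lambda>n. Re (exp_iter lam (r n + 2) z)) at_top sequentially"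
      by (rule filterlim_compose[OF relim])
    ultimately show False
      using not_tendsto_and_filterlim_at_infinity[OF sequentially_bot]
        filterlim_at_top_imp_at_infinity by blast
  qed
  then have "uniformly_to_infinity V ((\<lambda>n. exp_iter lam (n + 2)) \<circ> r)"
    using alt by blast
  then have big: "\<forall>\<^sub>F n in sequentially. \<forall>w\<in>V. L + 1 \<le> norm (exp_iter lam (r n + 2) w)"
    unfolding uniformly_to_infinity_def comp_def by blast
  obtain R where R: "R > 0" "ball z R \<subseteq> V" using V openE by blast
  have "\<forall>\<^sub>F n in sequentially. m \<le> r n"
    using rlim by (auto simp: filterlim_at_top)
  \<comment> \<open>The threshold exceeds by 1 the bound that the half-plane estimate gives
    below.\<close>
  moreover have "\<forall>\<^sub>F n in sequentially.
      norm (deriv (exp_iter lam (r n)) z) \<ge> exp 1 * (pi / 2) / R + 1"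
    using filterlim_compose[OF dlim rlim] by (auto simp: filterlim_at_top)
  ultimately have "\<forall>\<^sub>F n in sequentially. False"
    using big
  proof eventually_elim
    case (elim n)
    define F where "F = exp_iter lam (r n)"
    have contF: "continuous_on (ball z R) F"
      unfolding F_def by (intro holomorphic_on_imp_continuous_on exp_iter_holomorphic)
    have cos_pos: "cos (Im (F w)) > 0" if "w \<in> ball z R" for w
    proof -
      let ?x = "Re (exp_iter lam (Suc (r n)) w)"
      have "L + 1 \<le> norm (exp_iter lam (Suc (Suc (r n))) w)"
        using elim(3) that R by (auto simp del: exp_iter.simps)
      also have "\<dots> = lam (Suc (Suc (r n))) * exp ?x"
        using lam_pos by (simp only: norm_exp_iter_Suc abs_of_pos)
      also have "\<dots> \<le> L * exp ?x" using le by (simp add: mult_right_mono)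
      finally have *: "L + 1 \<le> L * exp ?x" .
      have "L > 0" using lam_pos[of 0] le[of 0] by linarith
      have "?x > 0"
      proof (rule ccontr)
        assume "\<not> ?x > 0"
        then have "L * exp ?x \<le> L * 1" using \<open>L > 0\<close> by (intro mult_left_mono) auto
        with * show False by linarith
      qed
      then show ?thesis
        unfolding Re_exp_iter_Suc F_def using lam_pos[of "Suc (r n)"]
        by (simp add: zero_less_mult_iff mult_less_0_iff)
    qed
    have Fz: "Im (F z) = 0" using real elim(1) by (simp add: F_def)
    \<comment> \<open>\<open>Im F\<close> vanishes at \<open>z\<close> and cannot cross
      \<open>- (pi / 2)\<close>, where the cosine is zero.\<close>
    have conn: "connected ((\<lambda>w. Im (F w)) ` ball z R)"
      by (intro connected_continuous_image continuous_intros contF) simp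
    have zball: "z \<in> ball z R" using R by simp
    have lower: "Im (F w) > - (pi / 2)" if "w \<in> ball z R" for w
    proof (rule ccontr)
      assume "\<not> ?thesis"
      then have "- (pi / 2) \<in> (\<lambda>w. Im (F w)) ` ball z R"
        using connectedD_interval[OF conn, of "Im (F w)" "Im (F z)" "- (pi / 2)"] that zball Fz
        by auto
      then obtain v where "v \<in> ball z R" "Im (F v) = - (pi / 2)" by (metis imageE)
      then show False using cos_pos[of v] by simp
    qed
    \<comment> \<open>One edge of the strip suffices: translation by \<open>\<i> * pi / 2\<close>
      moves the image into the upper half-plane.\<close>
    have "norm (deriv (\<lambda>w. F w + \<i> * of_real (pi / 2)) z) \<le>
        exp 1 * Im (F z + \<i> * of_real (pi / 2)) / R"
    proof (rule norm_deriv_le_Im)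
      show "(\<lambda>w. F w + \<i> * of_real (pi / 2)) holomorphic_on ball z R"
        unfolding F_def by (intro holomorphic_intros)
      show "Im (F w + \<i> * of_real (pi / 2)) > 0" if "w \<in> ball z R" for w
        using lower[OF that] by simp
    qed (use R in auto)
    moreover have "deriv (\<lambda>w. F w + \<i> * of_real (pi / 2)) z = deriv F z"
    proof -
      have "F field_differentiable at z"
        unfolding F_def using exp_iter_holomorphic[of lam "r n" UNIV]
        by (auto simp: holomorphic_on_open field_differentiable_def)
      then show ?thesis by simp
    qed
    ultimately show ?case using elim(2) Fz by (simp add: F_def)
  qed
  then show False by simp
qed

section \<open>The Julia set is the whole plane\<close>

theorem julia_set_eq_UNIV:
  assumes ge: "\<And>n. lam n \<ge> 1 / exp 1" and le: "\<And>n. lam n \<le> L"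
    and nsum: "\<not> summable (\<lambda>n. lam n - 1 / exp 1)"
  shows "julia_set lam = UNIV"
proof -
  have "z \<notin> fatou_set lam" for z
  proof
    assume "z \<in> fatou_set lam"
    then obtain U where U: "open U" "z \<in> U"
      and normal: "normal_family_on U (exp_iter lam ` {1..})"
      unfolding fatou_set_def by blast
    obtain R where R: "R > 0" "ball z R \<subseteq> U" using U openE by blast
    have zball: "z \<in> ball z R" using R by simp
    have nz: "Im (exp_iter lam n w) \<noteq> 0" if "w \<in> ball z R" for n w
      using normal_orbit_not_real[OF ge le nsum normal] that R by blast
    define y where "y = (\<lambda>n. Im (exp_iter lam n z))"
    \<comment> \<open>\<open>t k\<close> is the factor by which
      \<open>\<bar>F_k' z\<bar> / \<bar>y k\<bar>\<close> grows in one step, since \<open>\<bar>y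
      (k+1)\<bar> = \<bar>F_(k+1) z\<bar> * \<bar>sin (y k)\<bar>\<close>.\<close>
    define t where "t = (\<lambda>n. \<bar>y n\<bar> / \<bar>sin (y n)\<bar>)"
    define C where "C = \<bar>y 0\<bar> * exp 1 / R"
    have y_nz: "y n \<noteq> 0" for n using nz[OF zball] by (simp add: y_def)
    have sin_nz: "sin (y n) \<noteq> 0" for n
      using y_nz[of "Suc n"] unfolding y_def Im_exp_iter_Suc by auto
    have deriv_le: "norm (deriv (exp_iter lam n) z) \<le> exp 1 * \<bar>y n\<bar> / R" for n
    proof -
      let ?F = "exp_iter lam n"
      have conn: "connected ((\<lambda>w. Im (?F w)) ` ball z R)"
        by (intro connected_continuous_image continuous_intros
          holomorphic_on_imp_continuous_on exp_iter_holomorphic) simp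
      \<comment> \<open>A nonvanishing imaginary part has constant sign on the disc; multiplying by
        that sign puts the image in the upper half-plane.\<close>
      have same: "sgn (Im (?F w)) = sgn (y n)" if w: "w \<in> ball z R" for w
      proof (rule ccontr)
        assume "sgn (Im (?F w)) \<noteq> sgn (y n)"
        then have "0 \<in> (\<lambda>w. Im (?F w)) ` ball z R"
          using connectedD_interval[OF conn, of "Im (?F w)" "y n" 0]
            connectedD_interval[OF conn, of "y n" "Im (?F w)" 0] w zball
          by (fastforce simp: y_def sgn_if split: if_splits)
        then show False using nz by force
      qed
      have "norm (deriv (\<lambda>w. of_real (sgn (y n)) * ?F w) z) \<le>
          exp 1 * Im (of_real (sgn (y n)) * ?F z) / R"
      proof (rule norm_deriv_le_Im)
        show "(\<lambda>w. of_real (sgn (y n)) * ?F w) holomorphic_on ball z R"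
          by (intro holomorphic_intros)
        show "Im (of_real (sgn (y n)) * ?F w) > 0" if "w \<in> ball z R" for w
          using same[OF that] nz[OF that, of n] by (auto simp: sgn_if split: if_splits)
      qed (use R in auto)
      moreover have "deriv (\<lambda>w. of_real (sgn (y n)) * ?F w) z = of_real (sgn (y n)) * deriv ?F z"
        using exp_iter_holomorphic[of lam n UNIV]
        by (intro deriv_cmult) (auto simp: holomorphic_on_open field_differentiable_def)
      moreover have "Im (of_real (sgn (y n)) * ?F z) = \<bar>y n\<bar>"
        by (simp add: y_def abs_sgn mult.commute)
      ultimately show ?thesis
        using y_nz[of n] by (simp add: norm_mult abs_sgn_eq)
    qed
    have prod_t: "(\<Prod>k<n. t k) = \<bar>y 0\<bar> / \<bar>y n\<bar> * norm (deriv (exp_iter lam n) z)" for n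
    proof (induction n)
      case 0
      then show ?case using y_nz by (simp add: id_def)
    next
      case (Suc n)
      have "\<bar>y (Suc n)\<bar> = norm (exp_iter lam (Suc n) z) * \<bar>sin (y n)\<bar>"
        unfolding y_def Im_exp_iter_Suc norm_exp_iter_Suc by (simp add: abs_mult)
      then have "norm (exp_iter lam (Suc n) z) = \<bar>y (Suc n)\<bar> / \<bar>sin (y n)\<bar>"
        using sin_nz by (simp add: field_simps)
      then show ?case
        using Suc y_nz[of n] y_nz[of "Suc n"] sin_nz[of n]
        by (simp add: deriv_exp_iter norm_mult t_def del: exp_iter.simps)
    qed
    have prod_le: "(\<Prod>k<n. t k) \<le> C" for n
    proof -
      have "(\<Prod>k<n. t k) \<le> \<bar>y 0\<bar> / \<bar>y n\<bar> * (exp 1 * \<bar>y n\<bar> / R)"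
        unfolding prod_t using deriv_le by (intro mult_left_mono) auto
      also have "\<dots> = C" using y_nz[of n] by (simp add: C_def)
      finally show ?thesis .
    qed
    have t_ge: "1 + (1 - cos (y n)) / 4 \<le> t n" for n
      unfolding t_def by (rule one_minus_cos_le[OF sin_nz])
    have t_ge_1: "t n \<ge> 1" for n
      using t_ge[of n] by (rule order_trans[rotated]) simp
    have "summable (\<lambda>k. (1 - cos (y k)) / 4)"
    proof (rule bounded_imp_summable)
      show "(\<Sum>k\<le>n. (1 - cos (y k)) / 4) \<le> C" for n
      proof -
        have "(\<Sum>k\<le>n. (1 - cos (y k)) / 4) \<le> (\<Prod>k\<le>n. 1 + (1 - cos (y k)) / 4)"
          by (rule sum_le_prod) auto
        also have "\<dots> \<le> (\<Prod>k\<le>n. t k)"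
          using t_ge by (intro prod_mono) (auto intro: add_nonneg_nonneg)
        also have "\<dots> \<le> C" using prod_le[of "Suc n"] by (simp add: lessThan_Suc_atMost)
        finally show ?thesis .
      qed
    qed auto
    then have "summable (\<lambda>k. 1 - cos (Im (exp_iter lam k z)))"
      using summable_mult[of _ 4] by (fastforce simp: y_def)
    from norm_deriv_exp_iter_at_top[OF ge nsum this]
    have "\<forall>\<^sub>F n in sequentially. norm (deriv (exp_iter lam n) z) \<ge> exp 1 * C / R + 1"
      by (auto simp: filterlim_at_top)
    then obtain n where n: "norm (deriv (exp_iter lam n) z) \<ge> exp 1 * C / R + 1"
      by (auto simp: eventually_sequentially)
    \<comment> \<open>As all factors are at least 1, the bounded product controls its last factor
      \<open>t n\<close>, and with it the derivative at step \<open>n\<close>.\<close>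
    have "\<bar>y n\<bar> \<le> t n"
      using sin_nz[of n] by (simp add: t_def field_simps mult_left_le)
    also have "\<dots> \<le> (\<Prod>k<n. t k) * t n"
    proof -
      have "1 \<le> (\<Prod>k<n. t k)" by (rule prod_ge_1) (rule t_ge_1)
      then show ?thesis using t_ge_1[of n] by simp
    qed
    also have "\<dots> \<le> C" using prod_le[of "Suc n"] by simp
    finally have "exp 1 * \<bar>y n\<bar> / R \<le> exp 1 * C / R"
      using R by (simp add: divide_right_mono)
    with n deriv_le[of n] show False by linarith
  qed
  then show ?thesis by (auto simp: julia_set_def)
qed

theorem corollary3p9:
  fixes p :: real
  assumes "0 \<le> p" and "p < 1 / 2"
  shows "julia_set (\<lambda>n. 1 / exp 1 + 1 / real n powr p) = UNIV"
proof (rule julia_set_eq_UNIV)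
  show "1 / exp 1 + 1 / real n powr p \<le> 1 / exp 1 + 1" for n
  \<comment> \<open>At \<open>n = 0\<close> both \<open>powr\<close> and the division return 0, so
    the value is \<open>1 / exp 1\<close>.\<close>
  proof (cases "n = 0")
    case False
    then have "real n powr p \<ge> 1" using assms by (simp add: ge_one_powr_ge_zero)
    then show ?thesis using False by (subst add_le_cancel_left, subst pos_divide_le_eq) auto
  qed simp
  \<comment> \<open>The excess over \<open>1 / exp 1\<close> is this power, and
    \<open>- p \<ge> -1\<close>.\<close>
  have "\<not> summable (\<lambda>n. real n powr - p)"
    using assms by (subst summable_real_powr_iff) simp
  then show "\<not> summable (\<lambda>n. 1 / exp 1 + 1 / real n powr p - 1 / exp 1)"
    by (simp add: powr_minus_divide)
qed simp

end
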